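(* Let $k\geq 1$ and $m>n\geq 0$ be integers, and write $m-n=2^{s-1}r$ with $r$ odd (so $s\ge 1$). Then $$E_{2^km}^{(2^k)}(q)\equiv q^{2^{k-1}(m-n)}E_{2^kn}^{(2^k)}(q)\pmod{\prod_{i=0}^{s-1}\left(1+q^{2^{k+i-1}r}\right)}.$$
   Context: For $n\ge 1$ let $(a;q)_n=(1-a)(1-aq)\cdots(1-aq^{n-1})$, and $(a;q)_0=1$. For an integer $K\ge 1$, the generalized $q$-Euler numbers $E_{Kn}^{(K)}(q)$ ($n\ge 0$) are defined by the formal power series identity $$\sum_{n=0}^{\infty}E_{Kn}^{(K)}(q)\frac{x^{Kn}}{(q;q)_{Kn}}=\left(\sum_{n=0}^{\infty}\frac{x^{Kn}}{(q;q)_{Kn}}\right)^{-1}.$$ They are polynomials in $q$ with integer coefficients. Here they are used with $K=2^k$. Congruences between polynomials modulo a polynomial are understood in $\mathbb{Z}[q]$: $A(q)\equiv B(q)\pmod{C(q)}$ means that $C(q)$ divides $A(q)-B(q)$ in $\mathbb{Z}[q]$. *)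

theory Defs
  imports "HOL-Computational_Algebra.Computational_Algebra"
begin

definition q_poch :: "'a::comm_ring_1 \<Rightarrow> 'a \<Rightarrow> nat \<Rightarrow> 'a" where
  "q_poch a q n = (\<Prod>i<n. 1 - a * q ^ i)"

definition q_var :: "int poly" where
  "q_var = monom 1 1"

definition q_fact :: "nat \<Rightarrow> int poly" where
  "q_fact n = q_poch q_var q_var n"

(* The series sum_n x^(K n) / (q;q)_(K n) in the variable x, over the field of fractions of Z[q]. *)
definition q_euler_denom :: "nat \<Rightarrow> int poly fract fps" where
  "q_euler_denom K = Abs_fps (\<lambda>N. if K dvd N then 1 / to_fract (q_fact N) else 0)"

(* The second argument is the full subscript: E_{Kn}^{(K)}(q) is q_euler K (K * n).
   The polynomial p exists and is unique by to_fract_q_euler below. *)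
definition q_euler :: "nat \<Rightarrow> nat \<Rightarrow> int poly" where
  "q_euler K N = (THE p. fps_nth (inverse (q_euler_denom K)) N = to_fract p / to_fract (q_fact N))"

lemma q_poch_0 [simp]: "q_poch a q 0 = 1"
  by (simp add: q_poch_def)

lemma q_poch_Suc: "q_poch a q (Suc n) = q_poch a q n * (1 - a * q ^ n)"
  by (simp add: q_poch_def)

lemma q_fact_nonzero [simp]: "q_fact n \<noteq> 0"
proof -
  have "1 - q_var * q_var ^ i \<noteq> 0" for i
  proof
    assume "1 - q_var * q_var ^ i = 0"
    hence "poly (1 - q_var * q_var ^ i) 0 = 0" by simp
    thus False by (simp add: q_var_def poly_monom)
  qed
  thus ?thesis by (simp add: q_fact_def q_poch_def)
qed

lemma q_poch_mult_dvd:
  fixes q :: "'a::comm_ring_1"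
  shows "q_poch q q i * q_poch q q j dvd q_poch q q (i + j)"
proof (induction "i + j" arbitrary: i j)
  case 0
  then show ?case by simp
next
  case (Suc n)
  show ?case
  proof (cases "i = 0 \<or> j = 0")
    case True
    then show ?thesis by auto
  next
    case False
    then obtain a b where ab: "i = Suc a" "j = Suc b"
      by (metis not0_implies_Suc)
    have n: "n = a + Suc b" "n = Suc a + b" using Suc(2) ab by simp_all
    have d1: "q_poch q q a * q_poch q q (Suc b) dvd q_poch q q n"
      using Suc(1)[OF n(1)] n by simp
    have d2: "q_poch q q (Suc a) * q_poch q q b dvd q_poch q q n"
      using Suc(1)[OF n(2)] n by simp
    have "q ^ n = q ^ a * (q * q ^ b)"
      unfolding n by (simp add: power_add)
    hence e: "1 - q * q ^ n = (1 - q * q ^ a) + q * q ^ a * (1 - q * q ^ b)"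
      by (simp add: algebra_simps)
    have "i + j = Suc n" using Suc(2) by simp
    hence "q_poch q q (i + j) = q_poch q q n * (1 - q * q ^ a)
             + q * q ^ a * (q_poch q q n * (1 - q * q ^ b))"
      by (simp add: q_poch_Suc e algebra_simps)
    moreover have "q_poch q q i * q_poch q q j dvd q_poch q q n * (1 - q * q ^ a)"
      using mult_dvd_mono[OF d1 dvd_refl[of "1 - q * q ^ a"]]
      by (simp add: ab q_poch_Suc[of q q a] ac_simps)
    moreover have "q_poch q q i * q_poch q q j dvd q_poch q q n * (1 - q * q ^ b)"
      using mult_dvd_mono[OF d2 dvd_refl[of "1 - q * q ^ b"]]
      by (simp add: ab q_poch_Suc[of q q b] ac_simps)
    ultimately show ?thesis by (simp add: dvd_add dvd_mult)
  qed
qed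

lemma q_euler_denom_nth_0 [simp]: "fps_nth (q_euler_denom K) 0 = 1"
  by (simp add: q_euler_denom_def q_fact_def)

lemma inverse_q_euler_denom_rec:
  assumes "N > 0"
  shows "fps_nth (inverse (q_euler_denom K)) N =
    - (\<Sum>i<N. fps_nth (inverse (q_euler_denom K)) i * fps_nth (q_euler_denom K) (N - i))"
proof -
  have "inverse (q_euler_denom K) * q_euler_denom K = 1"
    by (rule inverse_mult_eq_1) simp
  hence "0 = fps_nth (inverse (q_euler_denom K) * q_euler_denom K) N"
    using assms by simp
  also have "\<dots> = (\<Sum>i\<le>N. fps_nth (inverse (q_euler_denom K)) i * fps_nth (q_euler_denom K) (N - i))"
    by (simp add: fps_mult_nth atLeast0AtMost)
  also have "{..N} = insert N {..<N}" by auto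
  finally show ?thesis by (simp add: eq_neg_iff_add_eq_0)
qed

lemma inverse_q_euler_denom_poly:
  "\<exists>p. fps_nth (inverse (q_euler_denom K)) N * to_fract (q_fact N) = to_fract p"
proof (induction N rule: less_induct)
  case (less N)
  let ?g = "fps_nth (inverse (q_euler_denom K))"
  show ?case
  proof (cases "N = 0")
    case True
    have "?g N * to_fract (q_fact N) = to_fract 1"
      by (simp add: True q_fact_def)
    then show ?thesis ..
  next
    case False
    have "\<exists>p. ?g i * fps_nth (q_euler_denom K) (N - i) * to_fract (q_fact N) = to_fract p"
      if i: "i < N" for i
    proof (cases "K dvd N - i")
      case True
      obtain p where p: "?g i * to_fract (q_fact i) = to_fract p"
        using less i by blast
      have "q_fact i * q_fact (N - i) dvd q_fact N"
        using q_poch_mult_dvd[of q_var i "N - i"] i by (simp add: q_fact_def)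
      then obtain c where c: "q_fact N = q_fact i * q_fact (N - i) * c" ..
      have "?g i * fps_nth (q_euler_denom K) (N - i) * to_fract (q_fact N)
            = (?g i * to_fract (q_fact i)) * to_fract c"
        using True by (simp add: q_euler_denom_def c)
      also have "\<dots> = to_fract (p * c)" by (simp add: p)
      finally show ?thesis by blast
    next
      case False
      have "?g i * fps_nth (q_euler_denom K) (N - i) * to_fract (q_fact N) = to_fract 0"
        using False by (simp add: q_euler_denom_def)
      then show ?thesis by blast
    qed
    then obtain P where P: "\<And>i. i < N \<Longrightarrow>
        ?g i * fps_nth (q_euler_denom K) (N - i) * to_fract (q_fact N) = to_fract (P i)"
      by metis
    have "?g N * to_fract (q_fact N) =
        - (\<Sum>i<N. ?g i * fps_nth (q_euler_denom K) (N - i) * to_fract (q_fact N))"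
      using False by (subst inverse_q_euler_denom_rec) (simp_all add: sum_distrib_right)
    also have "\<dots> = to_fract (- (\<Sum>i<N. P i))"
      by (simp add: P)
    finally show ?thesis by blast
  qed
qed

lemma to_fract_q_euler:
  "to_fract (q_euler K N) / to_fract (q_fact N) = fps_nth (inverse (q_euler_denom K)) N"
proof -
  let ?P = "\<lambda>p. fps_nth (inverse (q_euler_denom K)) N = to_fract p / to_fract (q_fact N)"
  obtain p where "fps_nth (inverse (q_euler_denom K)) N * to_fract (q_fact N) = to_fract p"
    using inverse_q_euler_denom_poly by blast
  hence p: "?P p" by (simp add: field_simps)
  have "?P (THE p. ?P p)"
  proof (rule theI[of ?P, OF p])
    fix p' assume "?P p'"
    with p show "p' = p" by simp
  qed
  thus ?thesis by (simp add: q_euler_def)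
qed

lemma inverse_q_euler_denom_eq_0:
  "\<not> K dvd N \<Longrightarrow> fps_nth (inverse (q_euler_denom K)) N = 0"
proof (induction N rule: less_induct)
  case (less N)
  have "fps_nth (inverse (q_euler_denom K)) i * fps_nth (q_euler_denom K) (N - i) = 0"
    if i: "i < N" for i
  proof (cases "K dvd i")
    case True
    hence "\<not> K dvd N - i" using less.prems i by (metis dvd_diffD less_imp_le)
    thus ?thesis by (simp add: q_euler_denom_def)
  qed (use less.IH i in simp)
  moreover have "N > 0" using less.prems by (cases N) auto
  ultimately show ?case by (simp add: inverse_q_euler_denom_rec sum.neutral del: mult_eq_0_iff)
qed

(* The defining identity of the generalized q-Euler numbers. *)
lemma q_euler_fps:
  "Abs_fps (\<lambda>N. if K dvd N then to_fract (q_euler K N) / to_fract (q_fact N) else 0)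
     = inverse (q_euler_denom K)"
  by (rule fps_ext) (simp add: to_fract_q_euler inverse_q_euler_denom_eq_0)

end

theory Submission
  imports Defs
begin

text \<open>
  Let \<open>K = 2^k\<close> and \<open>M = 2^(k-1) r\<close>. The modulus is \<open>(1 - q^(2^s M)) / (1 - q^M)\<close>, which is monic and has
  only simple complex roots, so it suffices to verify the congruence at each complex \<open>z\<close> with
  \<open>z^(2^s M) = 1 \<noteq> z^M\<close>. The order \<open>N\<close> of such a \<open>z\<close> is a multiple of \<open>K\<close>. By the q-Lucas theorem the
  recurrence \<open>\<Sum> [n choose i]_z E_i = \<delta>_(n,0)\<close>, taken over \<open>i \<le> n\<close> with \<open>i \<equiv> n (mod K)\<close>, factors into one in
  \<open>n mod N\<close> and one in \<open>n div N\<close>, and the latter is an alternating sum of ordinary binomial coefficients;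
  hence \<open>E_(n+N)(z) = - E_n(z)\<close>, while also \<open>z^(N/2) = -1\<close>.
\<close>

section \<open>q-binomial coefficients and the q-Lucas theorem\<close>

text \<open>Pascal's rule serves as the definition because the quotient of q-factorials can become
  0/0 at a root of unity.\<close>

fun qbinom :: "'a::comm_ring_1 \<Rightarrow> nat \<Rightarrow> nat \<Rightarrow> 'a" where
  "qbinom q n 0 = 1"
| "qbinom q 0 (Suc k) = 0"
| "qbinom q (Suc n) (Suc k) = qbinom q n k + q ^ Suc k * qbinom q n (Suc k)"

lemma qbinom_eq_0: "n < k \<Longrightarrow> qbinom q n k = 0"
  by (induction q n k rule: qbinom.induct) auto

lemma qbinom_same [simp]: "qbinom q n n = 1"
  by (induction n) (auto simp: qbinom_eq_0)

text \<open>Division-free quotient formula. The two Pascal terms contribute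
  \<open>(1 - q^k) + q^k (1 - q^l) = 1 - q^(k+l)\<close>.\<close>

lemma qbinom_mult_q_poch:
  "qbinom q (k + l) k * q_poch q q k * q_poch q q l = q_poch q q (k + l)"
proof (induction "k + l" arbitrary: k l)
  case 0
  then show ?case by simp
next
  case (Suc n)
  show ?case
  proof (cases k)
    case 0
    then show ?thesis by simp
  next
    case k: (Suc a)
    show ?thesis
    proof (cases l)
      case 0
      then show ?thesis by simp
    next
      case l: (Suc b)
      have n: "n = a + Suc b" "n = Suc a + b" using Suc(2) k l by simp_all
      have e1: "qbinom q n a * q_poch q q a * q_poch q q (Suc b) = q_poch q q n"
        using Suc(1)[OF n(1)] n by simp
      have e2: "qbinom q n (Suc a) * q_poch q q (Suc a) * q_poch q q b = q_poch q q n"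
        using Suc(1)[OF n(2)] n by simp
      have kl: "k + l = Suc n" using Suc(2) by simp
      have "qbinom q (k + l) k * q_poch q q k * q_poch q q l =
          (qbinom q n a * q_poch q q a * q_poch q q (Suc b)) * (1 - q * q ^ a) +
          q * q ^ a * ((qbinom q n (Suc a) * q_poch q q (Suc a) * q_poch q q b) * (1 - q * q ^ b))"
        unfolding kl by (simp add: k l q_poch_Suc algebra_simps)
      also have "\<dots> = q_poch q q n * (1 - q * (q * q ^ a * q ^ b))"
        unfolding e1 e2 by (simp add: algebra_simps)
      also have "q * q ^ a * q ^ b = q ^ n"
        by (simp add: n power_add)
      finally show ?thesis
        by (simp add: kl q_poch_Suc)
    qed
  qed
qed

lemma q_poch_nonzero:
  fixes z :: "'a::idom"
  assumes "\<And>j. 0 < j \<Longrightarrow> j < N \<Longrightarrow> z ^ j \<noteq> 1" and "n < N"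
  shows "q_poch z z n \<noteq> 0"
proof -
  have "z * z ^ i \<noteq> 1" if "i < n" for i
    using assms(1)[of "Suc i"] assms(2) that by simp
  thus ?thesis by (simp add: q_poch_def)
qed

text \<open>In the product formula, \<open>q_poch z z N\<close> contains the factor
  \<open>1 - z^N = 0\<close>, while the two shorter products are nonzero by minimality of
  \<open>N\<close>.\<close>

lemma qbinom_root_of_unity:
  fixes z :: "'a::idom"
  assumes "z ^ N = 1" "\<And>j. 0 < j \<Longrightarrow> j < N \<Longrightarrow> z ^ j \<noteq> 1" and "0 < k" "k < N"
  shows "qbinom z N k = 0"
proof -
  obtain M where M: "N = Suc M" using assms(4) by (cases N) auto
  have "q_poch z z N = 0"
    using assms(1) by (simp add: M q_poch_Suc)
  moreover have "qbinom z N k * q_poch z z k * q_poch z z (N - k) = q_poch z z N"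
    using qbinom_mult_q_poch[of z k "N - k"] assms(4) by simp
  ultimately show ?thesis
    using q_poch_nonzero[OF assms(2), of N k] q_poch_nonzero[OF assms(2), of N "N - k"] assms(3,4)
    by simp
qed

text \<open>The q-Lucas theorem. Pascal's rule drives an induction on the upper index: the weights
  satisfy \<open>z^(c*N) = 1\<close>, so only the lowest base-\<open>N\<close> digit sees
  \<open>z\<close>, and carries produce the ordinary Pascal rule.\<close>

lemma qbinom_lucas:
  fixes z :: "'a::idom"
  assumes z: "z ^ N = 1" "\<And>j. 0 < j \<Longrightarrow> j < N \<Longrightarrow> z ^ j \<noteq> 1" and "b < N" "d < N"
  shows "qbinom z (a * N + b) (c * N + d) = of_nat (a choose c) * qbinom z b d"
proof -
  have zc: "z ^ (c * N) = 1" for c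
    by (metis z(1) mult.commute power_mult power_one)
  have "qbinom z n (c * N + d) = of_nat ((n div N) choose c) * qbinom z (n mod N) d"
    if "d < N" for n c d
    using that
  proof (induction n arbitrary: c d)
    case 0
    then show ?case
      by (cases c; cases d) (auto simp: qbinom_eq_0)
  next
    case (Suc n)
    define a b where "a = n div N" and "b = n mod N"
    have "b < N" using Suc.prems by (simp add: b_def)
    have IH: "qbinom z n (c * N + d) = of_nat (a choose c) * qbinom z b d" if "d < N" for c d
      using Suc.IH[OF that] by (simp add: a_def b_def)
    have n: "n = a * N + b" by (simp add: a_def b_def)
    obtain M where M: "N = Suc M" using Suc.prems by (cases N) auto
    \<comment> \<open>A lower index with last digit 0 borrows: its predecessor has last digit
      \<open>M = N - 1\<close> and leading part \<open>c'\<close>.\<close>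
    have pascal0: "qbinom z (Suc n) (Suc c' * N) = of_nat (a choose c') * qbinom z b M
        + of_nat (a choose Suc c')" for c'
    proof -
      have "Suc c' * N = Suc (c' * N + M)" by (simp add: M)
      hence "qbinom z (Suc n) (Suc c' * N) =
          qbinom z n (c' * N + M) + z ^ (Suc c' * N) * qbinom z n (Suc c' * N)"
        by (metis qbinom.simps(3))
      thus ?thesis
        using IH[of M c'] IH[of 0 "Suc c'"] zc[of "Suc c'"] by (simp add: M)
    qed
    have pascal: "qbinom z (Suc n) (c * N + Suc d') =
        of_nat (a choose c) * qbinom z (Suc b) (Suc d')" if "Suc d' < N" for d'
      using IH[of d' c] IH[of "Suc d'" c] that zc[of c] by (simp add: power_add algebra_simps)
    show ?case
    proof (cases "Suc b < N")
      case True
      have "Suc n = a * N + Suc b" by (simp add: n)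
      hence div: "Suc n div N = a" "Suc n mod N = Suc b"
        using True by (simp_all only: div_mult_self3 mod_mult_self3 div_less mod_less)
      show ?thesis
      proof (cases d)
        case d: 0
        show ?thesis
        proof (cases c)
          case c: (Suc c')
          have "b < M" using True M by simp
          thus ?thesis unfolding div using pascal0[of c'] c d
            by (simp add: qbinom_eq_0)
        qed (simp add: d)
      qed (use pascal Suc.prems div in simp)
    next
      case False
      hence b: "b = M" using \<open>b < N\<close> M by simp
      have "Suc n = Suc a * N" by (simp add: n b M)
      hence div: "Suc n div N = Suc a" "Suc n mod N = 0" using Suc.prems by auto
      show ?thesis
      proof (cases d)
        case d: 0
        show ?thesis
        proof (cases c)
          case c: (Suc c')
          show ?thesis unfolding div using pascal0[of c'] c d b by simp
        qed (simp add: d)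
      next
        case d: (Suc d')
        \<comment> \<open>The upper digit has rolled over from \<open>N - 1\<close> to 0, so the
          claimed value is \<open>qbinom z 0 d = 0\<close>; here \<open>Suc b = N\<close>.\<close>
        have "qbinom z (Suc b) (Suc d') = 0"
          using qbinom_root_of_unity[OF z, of "Suc d'"] Suc.prems d M b by simp
        thus ?thesis using pascal[of d'] Suc.prems div d by simp
      qed
    qed
  qed
  from this[of d "a * N + b" c] show ?thesis using assms(3,4) by simp
qed

section \<open>The q-Euler recurrence and its solutions at a root of unity\<close>

text \<open>This is coefficient \<open>n\<close> of
  \<open>inverse (q_euler_denom K) * q_euler_denom K = 1\<close>, multiplied by
  \<open>q_fact n\<close> to turn the quotients into q-binomials.\<close>

lemma q_euler_rec:
  "(\<Sum>i\<le>n. if K dvd n - i then qbinom q_var n i * q_euler K i else 0) = (if n = 0 then 1 else 0)"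
proof -
  let ?g = "fps_nth (inverse (q_euler_denom K))"
  have "?g i * fps_nth (q_euler_denom K) (n - i) * to_fract (q_fact n) =
      to_fract (if K dvd n - i then qbinom q_var n i * q_euler K i else 0)" if "i \<le> n" for i
  proof -
    have "q_fact n = qbinom q_var n i * q_fact i * q_fact (n - i)"
      using qbinom_mult_q_poch[of q_var i "n - i"] that by (simp add: q_fact_def)
    moreover have "fps_nth (q_euler_denom K) (n - i) =
        (if K dvd n - i then 1 / to_fract (q_fact (n - i)) else 0)"
      by (simp add: q_euler_denom_def)
    ultimately show ?thesis
      by (simp add: to_fract_q_euler[symmetric])
  qed
  hence "to_fract (\<Sum>i\<le>n. if K dvd n - i then qbinom q_var n i * q_euler K i else 0) =
      (\<Sum>i\<le>n. ?g i * fps_nth (q_euler_denom K) (n - i)) * to_fract (q_fact n)"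
    by (simp add: sum_distrib_right)
  also have "(\<Sum>i\<le>n. ?g i * fps_nth (q_euler_denom K) (n - i)) =
      fps_nth (inverse (q_euler_denom K) * q_euler_denom K) n"
    by (simp add: fps_mult_nth atLeast0AtMost)
  also have "inverse (q_euler_denom K) * q_euler_denom K = 1"
    by (rule inverse_mult_eq_1) simp
  also have "fps_nth 1 n * to_fract (q_fact n) = to_fract (if n = 0 then 1 else 0)"
    by (simp add: q_fact_def)
  finally show ?thesis by (simp only: to_fract_eq_iff)
qed

text \<open>The recurrence is imposed for all \<open>n\<close>, so it also forces \<open>e n = 0\<close> when \<open>\<not> K dvd n\<close>.\<close>

definition is_q_euler :: "nat \<Rightarrow> 'a::comm_ring_1 \<Rightarrow> (nat \<Rightarrow> 'a) \<Rightarrow> bool" where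
  "is_q_euler K z e \<longleftrightarrow>
     (\<forall>n. (\<Sum>i\<le>n. if K dvd n - i then qbinom z n i * e i else 0) = (if n = 0 then 1 else 0))"

text \<open>The coefficient of \<open>e n\<close> in the recurrence is
  \<open>qbinom z n n = 1\<close>, so earlier values determine it for every
  \<open>z\<close>.\<close>

lemma is_q_euler_unique:
  assumes "is_q_euler K z e" and "is_q_euler K z f"
  shows "e n = f n"
proof (induction n rule: less_induct)
  case (less n)
  have "(\<Sum>i\<le>n. if K dvd n - i then qbinom z n i * e i else 0) =
        (\<Sum>i\<le>n. if K dvd n - i then qbinom z n i * f i else 0)"
    using assms by (simp add: is_q_euler_def)
  moreover have "(\<Sum>i<n. if K dvd n - i then qbinom z n i * e i else 0) =
        (\<Sum>i<n. if K dvd n - i then qbinom z n i * f i else 0)"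
    by (intro sum.cong refl) (use less in auto)
  moreover have "{..n} = insert n {..<n}" by auto
  ultimately show ?case by simp
qed

text \<open>With \<open>n = a*N + b\<close> and \<open>i = c*N + d\<close>, q-Lucas splits the sum
  into an alternating binomial sum, zero unless \<open>a = 0\<close>, and the recurrence of
  \<open>e\<close> at \<open>b\<close>. Since \<open>K\<close> divides \<open>N\<close>, the residue
  condition involves only \<open>b\<close> and \<open>d\<close>.\<close>

lemma is_q_euler_mod:
  fixes z :: "'a::idom"
  assumes z: "z ^ N = 1" "\<And>j. 0 < j \<Longrightarrow> j < N \<Longrightarrow> z ^ j \<noteq> 1" and "N > 0" "K dvd N"
    and e: "is_q_euler K z e"
  shows "is_q_euler K z (\<lambda>i. (-1) ^ (i div N) * e (i mod N))"
  unfolding is_q_euler_def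
proof
  fix n
  let ?f = "\<lambda>i. (-1) ^ (i div N) * e (i mod N)"
  define a b where "a = n div N" and "b = n mod N"
  have n: "n = a * N + b" and b: "b < N"
    using \<open>N > 0\<close> by (simp_all add: a_def b_def)
  have dvd_iff: "K dvd n' - i \<longleftrightarrow> n' mod K = i mod K" if "i \<le> n'" for i n' :: nat
    using that by (metis mod_eq_dvd_iff_nat)
  have mod_add: "(c * N + d) mod K = d mod K" for c d
    using \<open>K dvd N\<close> by (metis dvd_mult mod_add_left_eq mod_0_imp_dvd dvd_imp_mod_0 add_0)
  \<comment> \<open>Added terms vanish since \<open>qbinom z n' i = 0\<close> for
    \<open>i > n'\<close>. This pads the range to full blocks of length \<open>N\<close>, and later
    trims \<open>d < N\<close> back to \<open>d \<le> b\<close>.\<close>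
  have extend: "(\<Sum>i\<le>n'. if K dvd n' - i then qbinom z n' i * g i else 0) =
      (\<Sum>i<l. if n' mod K = i mod K then qbinom z n' i * g i else 0)"
    if "n' < l" for n' l and g :: "nat \<Rightarrow> 'a"
    by (rule sum.mono_neutral_cong_left) (use that in \<open>auto simp: dvd_iff qbinom_eq_0\<close>)
  have "(\<Sum>i\<le>n. if K dvd n - i then qbinom z n i * ?f i else 0) =
      (\<Sum>i<Suc a * N. if n mod K = i mod K then qbinom z n i * ?f i else 0)"
    by (rule extend) (use n b in simp)
  also have "\<dots> = (\<Sum>c<Suc a. \<Sum>i=c*N..<c*N+N.
      if n mod K = i mod K then qbinom z n i * ?f i else 0)"
    by (rule sum.nat_group[symmetric])
  also have "\<dots> = (\<Sum>c<Suc a. \<Sum>d<N.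
      (-1) ^ c * of_nat (a choose c) * (if b mod K = d mod K then qbinom z b d * e d else 0))"
  proof (rule sum.cong[OF refl])
    fix c
    have "(\<Sum>i=c*N..<c*N+N. if n mod K = i mod K then qbinom z n i * ?f i else 0) =
       (\<Sum>d<N. if n mod K = (c*N+d) mod K then qbinom z n (c*N+d) * ?f (c*N+d) else 0)"
      by (simp add: sum.atLeastLessThan_shift_0 atLeast0LessThan)
    also have "\<dots> = (\<Sum>d<N. (-1) ^ c * of_nat (a choose c) *
        (if b mod K = d mod K then qbinom z b d * e d else 0))"
      by (intro sum.cong refl) (use b in \<open>auto simp: n mod_add qbinom_lucas[OF z]\<close>)
    finally show "(\<Sum>i=c*N..<c*N+N. if n mod K = i mod K then qbinom z n i * ?f i else 0) =
        (\<Sum>d<N. (-1) ^ c * of_nat (a choose c) *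
          (if b mod K = d mod K then qbinom z b d * e d else 0))" .
  qed
  also have "\<dots> = (\<Sum>c\<le>a. (-1) ^ c * of_nat (a choose c)) *
      (\<Sum>d<N. if b mod K = d mod K then qbinom z b d * e d else 0)"
    by (simp only: sum_product lessThan_Suc_atMost)
  also have "(\<Sum>c\<le>a. (-1) ^ c * of_nat (a choose c)) = (if a = 0 then 1 else (0::'a))"
    using choose_alternating_sum[of a] by auto
  also have "(\<Sum>d<N. if b mod K = d mod K then qbinom z b d * e d else 0) = (if b = 0 then 1 else 0)"
    using extend[OF b, of e] e by (simp add: is_q_euler_def)
  finally show "(\<Sum>i\<le>n. if K dvd n - i then qbinom z n i * ?f i else 0) = (if n = 0 then 1 else 0)"
    using \<open>N > 0\<close> by (auto simp: n)
qed

lemma is_q_euler_shift: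
  fixes z :: "'a::idom"
  assumes "z ^ N = 1" "\<And>j. 0 < j \<Longrightarrow> j < N \<Longrightarrow> z ^ j \<noteq> 1" and "N > 0" "K dvd N"
    and "is_q_euler K z e"
  shows "e (i + j * N) = (-1) ^ j * e i"
proof -
  have *: "e n = (-1) ^ (n div N) * e (n mod N)" for n
    using is_q_euler_unique[OF assms(5) is_q_euler_mod[OF assms]] .
  show ?thesis
    using *[of "i + j * N"] *[of i] \<open>N > 0\<close> by (simp add: power_add)
qed

section \<open>Evaluation of integer polynomials\<close>

definition int_poly_eval :: "'a::comm_ring_1 \<Rightarrow> int poly \<Rightarrow> 'a" where
  "int_poly_eval z p = poly (map_poly of_int p) z"

lemma int_poly_eval_0 [simp]: "int_poly_eval z 0 = 0"
  and int_poly_eval_1 [simp]: "int_poly_eval z 1 = 1"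
  and int_poly_eval_pCons: "int_poly_eval z (pCons a p) = of_int a + z * int_poly_eval z p"
  by (simp_all add: int_poly_eval_def map_poly_pCons)

lemma int_poly_eval_add [simp]: "int_poly_eval z (p + q) = int_poly_eval z p + int_poly_eval z q"
proof -
  have "map_poly of_int (p + q) = (map_poly of_int p + map_poly of_int q :: 'a poly)"
    by (rule poly_eqI) (simp add: coeff_map_poly)
  thus ?thesis by (simp add: int_poly_eval_def)
qed

lemma int_poly_eval_smult: "int_poly_eval z (smult c p) = of_int c * int_poly_eval z p"
  by (simp add: int_poly_eval_def map_poly_smult)

lemma int_poly_eval_diff [simp]: "int_poly_eval z (p - q) = int_poly_eval z p - int_poly_eval z q"
  using int_poly_eval_add[of z "p - q" q] by (simp add: algebra_simps)

lemma int_poly_eval_mult [simp]: "int_poly_eval z (p * q) = int_poly_eval z p * int_poly_eval z q"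
  by (induction p) (simp_all add: int_poly_eval_pCons int_poly_eval_smult algebra_simps)

lemma int_poly_eval_power [simp]: "int_poly_eval z (p ^ n) = int_poly_eval z p ^ n"
  by (induction n) simp_all

lemma int_poly_eval_sum [simp]: "int_poly_eval z (sum f A) = (\<Sum>i\<in>A. int_poly_eval z (f i))"
  by (induction A rule: infinite_finite_induct) simp_all

lemma int_poly_eval_q_var [simp]: "int_poly_eval z q_var = z"
  by (simp add: int_poly_eval_def q_var_def map_poly_monom poly_monom)

lemma int_poly_eval_qbinom [simp]: "int_poly_eval z (qbinom q n k) = qbinom (int_poly_eval z q) n k"
  by (induction q n k rule: qbinom.induct) simp_all

text \<open>The recurrence is free of denominators, so it specializes even where q-factorials
  vanish.\<close>

lemma is_q_euler_eval: "is_q_euler K z (\<lambda>i. int_poly_eval z (q_euler K i))"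
  unfolding is_q_euler_def
proof
  fix n
  have "int_poly_eval z (\<Sum>i\<le>n. if K dvd n - i then qbinom q_var n i * q_euler K i else 0) =
      int_poly_eval z (if n = 0 then 1 else 0)"
    by (simp only: q_euler_rec)
  thus "(\<Sum>i\<le>n. if K dvd n - i then qbinom z n i * int_poly_eval z (q_euler K i) else 0) =
      (if n = 0 then 1 else 0)"
    by (simp add: if_distrib[of "int_poly_eval z"] cong: if_cong)
qed

section \<open>Divisibility by a monic polynomial and the shape of the modulus\<close>

text \<open>Division by a monic polynomial stays over the integers; the remainder vanishes on
  \<open>S\<close> but has degree below \<open>card S\<close>, so it is zero.\<close>

lemma monic_dvd_if_common_roots:
  fixes D A :: "int poly" and S :: "'a::{idom,ring_char_0} set"
  assumes D: "lead_coeff D = 1" and "finite S" and "degree D \<le> card S"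
    and S: "\<And>z. z \<in> S \<Longrightarrow> int_poly_eval z D = 0" "\<And>z. z \<in> S \<Longrightarrow> int_poly_eval z A = 0"
  shows "D dvd A"
proof -
  obtain Q R where QR: "pseudo_divmod A D = (Q, R)" by fastforce
  have D0: "D \<noteq> 0" using D by auto
  \<comment> \<open>Pseudo-division scales \<open>A\<close> by a power of the leading coefficient of
    \<open>D\<close>, which is 1.\<close>
  have A: "A = D * Q + R" and deg: "R = 0 \<or> degree R < degree D"
    using pseudo_divmod[OF D0 QR] D by simp_all
  have "R = 0"
  proof (rule ccontr)
    assume R: "R \<noteq> 0"
    let ?R = "map_poly of_int R :: 'a poly"
    have R': "?R \<noteq> 0" using R by (simp add: map_poly_eq_0_iff)
    have "S \<subseteq> {z. poly ?R z = 0}"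
      using S by (auto simp: A int_poly_eval_def[symmetric])
    hence "card S \<le> card {z. poly ?R z = 0}"
      by (intro card_mono poly_roots_finite R')
    also have "\<dots> \<le> degree ?R" by (rule card_poly_roots_bound[OF R'])
    also have "\<dots> \<le> degree R" by (rule map_poly_degree_leq)
    finally show False using deg R assms(3) by simp
  qed
  thus ?thesis using A by simp
qed

lemma prod_one_plus_power_doubling:
  fixes x :: "'a::comm_ring_1"
  shows "(\<Prod>i<s. 1 + x ^ (2 ^ i * M)) * (1 - x ^ M) = 1 - x ^ (2 ^ s * M)"
proof (induction s)
  case (Suc s)
  have "(\<Prod>i<Suc s. 1 + x ^ (2 ^ i * M)) * (1 - x ^ M) =
      (1 + x ^ (2 ^ s * M)) * ((\<Prod>i<s. 1 + x ^ (2 ^ i * M)) * (1 - x ^ M))"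
    by (simp add: mult_ac)
  also have "\<dots> = 1 - x ^ (2 ^ s * M) * x ^ (2 ^ s * M)"
    unfolding Suc by (simp add: algebra_simps)
  also have "x ^ (2 ^ s * M) * x ^ (2 ^ s * M) = x ^ (2 ^ Suc s * M)"
    by (simp add: power_add[symmetric] algebra_simps flip: mult_2)
  finally show ?case .
qed simp

lemma one_plus_q_var_power:
  assumes "a > 0"
  shows "degree (1 + q_var ^ a) = a" "lead_coeff (1 + q_var ^ a) = 1"
proof -
  have q: "q_var ^ a = monom 1 a" by (simp add: q_var_def monom_power)
  show deg: "degree (1 + q_var ^ a) = a"
    using assms by (subst add.commute, subst degree_add_eq_left) (simp_all add: q degree_monom_eq)
  show "lead_coeff (1 + q_var ^ a) = 1"
    unfolding deg using assms by (simp add: q)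
qed

section \<open>Orders of roots of unity and the congruence\<close>

lemma obtain_multiplicative_order:
  fixes z :: "'a::monoid_mult"
  assumes "z ^ L = 1" "L > 0"
  obtains N where "N > 0" "z ^ N = 1" "\<And>j. 0 < j \<Longrightarrow> j < N \<Longrightarrow> z ^ j \<noteq> 1" "\<And>l. z ^ l = 1 \<longleftrightarrow> N dvd l"
proof -
  define N where "N = (LEAST j. 0 < j \<and> z ^ j = 1)"
  have N: "0 < N \<and> z ^ N = 1"
    unfolding N_def by (rule LeastI[of _ L]) (use assms in simp)
  have least: "z ^ j \<noteq> 1" if "0 < j" "j < N" for j
    using not_less_Least[of j "\<lambda>j. 0 < j \<and> z ^ j = 1"] that by (auto simp: N_def)
  have "z ^ l = 1 \<longleftrightarrow> N dvd l" for l
  proof -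
    have "z ^ l = z ^ (N * (l div N) + l mod N)" by simp
    also have "\<dots> = z ^ (l mod N)"
      unfolding power_add power_mult using N by simp
    finally show ?thesis
      using least[of "l mod N"] N by (auto simp: dvd_eq_mod_eq_0)
  qed
  thus thesis using that N least by blast
qed

text \<open>The odd part of \<open>N\<close> divides \<open>r\<close>, so if the 2-adic valuation of
  \<open>N\<close> were at most \<open>k\<close>, then \<open>N\<close> would divide
  \<open>2^k * r\<close>.\<close>

lemma power_2_dvd_if:
  fixes N r :: nat
  assumes "odd r" "N dvd 2 ^ t * r" "\<not> N dvd 2 ^ k * r"
  shows "2 ^ Suc k dvd N"
proof -
  have "N \<noteq> 0" using assms(1,2) by (intro notI) auto
  then obtain u where u: "N = 2 ^ multiplicity 2 N * u" "odd u"
    using multiplicity_decompose'[of N 2] by auto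
  have "u dvd 2 ^ t * r" using u assms(2) by (metis dvd_mult_right)
  hence "u dvd r" using u(2) by (simp add: coprime_dvd_mult_right_iff)
  have "\<not> multiplicity 2 N \<le> k"
    using mult_dvd_mono[OF le_imp_power_dvd \<open>u dvd r\<close>, of "multiplicity 2 N" k 2] u(1) assms(3) by auto
  thus ?thesis by (intro multiplicity_dvd') simp
qed

text \<open>Shifting the index by \<open>j\<close> periods gives the sign \<open>(-1)^j\<close>, and
  \<open>z^(N div 2) = -1\<close> rewrites that sign as a power of \<open>z\<close>.\<close>

lemma q_euler_congruence_at_root_of_unity:
  fixes z :: "'a::idom"
  assumes K: "K dvd N" "even N" "N > 0" and "n \<le> m" "K * (m - n) = j * N"
    and z: "z ^ N = 1" "\<And>j. 0 < j \<Longrightarrow> j < N \<Longrightarrow> z ^ j \<noteq> 1"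
  shows "int_poly_eval z (q_euler K (K * m)) =
    z ^ (N div 2 * j) * int_poly_eval z (q_euler K (K * n))"
proof -
  have "(z ^ (N div 2)) ^ 2 = 1"
    using K z(1) by (simp flip: power_mult)
  \<comment> \<open>\<open>N div 2\<close> is positive and below the order \<open>N\<close>, as
    \<open>N\<close> is even and positive.\<close>
  moreover have "z ^ (N div 2) \<noteq> 1" using K by (intro z(2)) auto
  ultimately have half: "z ^ (N div 2) = -1" by (simp add: power2_eq_1_iff)
  have "K * m = K * n + j * N"
    using assms(4,5) by (metis distrib_left le_add_diff_inverse)
  thus ?thesis
    using is_q_euler_shift[OF z \<open>N > 0\<close> \<open>K dvd N\<close> is_q_euler_eval, of "K * n" j]
    by (simp add: power_mult half)
qed

theorem corollary5p3:
  fixes k m n s r :: nat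
  assumes "k \<ge> 1" and "m > n" and "s \<ge> 1" and "odd r" and "m - n = 2 ^ (s - 1) * r"
  shows "(\<Prod>i = 0..s - 1. 1 + q_var ^ (2 ^ (k + i - 1) * r)) dvd
           q_euler (2 ^ k) (2 ^ k * m) - q_var ^ (2 ^ (k - 1) * (m - n)) * q_euler (2 ^ k) (2 ^ k * n)"
proof -
  define M where "M = 2 ^ (k - 1) * r"
  define L where "L = 2 ^ s * M"
  define D where "D = (\<Prod>i<s. 1 + q_var ^ (2 ^ i * M))"
  \<comment> \<open>These are roots of \<open>D\<close>, by
    \<open>D * (1 - q^M) = 1 - q^L\<close>.\<close>
  define S where "S = {z::complex. z ^ L = 1} - {z. z ^ M = 1}"
  have "M > 0" using \<open>odd r\<close> by (auto simp: M_def intro!: Nat.gr0I)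
  hence "L > 0" by (simp add: L_def)
  have K: "2 ^ k = 2 * (2::nat) ^ (k - 1)"
    using \<open>k \<ge> 1\<close> by (metis power_Suc Suc_pred' less_eq_Suc_le One_nat_def)
  have s2: "2 ^ s = 2 * (2::nat) ^ (s - 1)"
    using \<open>s \<ge> 1\<close> by (metis power_Suc Suc_pred' less_eq_Suc_le One_nat_def)
  \<comment> \<open>The exponent \<open>L\<close> equals the index shift, so the order of each
    \<open>z\<close> in \<open>S\<close> divides that shift.\<close>
  have L: "2 ^ k * (m - n) = L"
    by (simp add: assms(5) K s2 L_def M_def)
  have prod_eq: "(\<Prod>i = 0..s - 1. 1 + q_var ^ (2 ^ (k + i - 1) * r)) = D"
    unfolding D_def
    by (intro prod.cong)
      (use assms in \<open>auto simp: M_def power_add[symmetric] mult.assoc[symmetric] add.commute\<close>)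
  have "lead_coeff D = 1"
    unfolding D_def lead_coeff_prod
    using \<open>M > 0\<close> by (intro prod.neutral ballI one_plus_q_var_power(2)) simp
  moreover have "finite S" using \<open>L > 0\<close> by (simp add: S_def finite_roots_unity)
  \<comment> \<open>Both numbers are compared with \<open>L - M\<close>: the degrees form a
    geometric sum, and there are \<open>L\<close> and \<open>M\<close> complex roots of unity to
    count.\<close>
  moreover have "degree D \<le> card S"
  proof -
    have nz: "1 + q_var ^ (2 ^ i * M) \<noteq> 0" for i
      using one_plus_q_var_power(2)[of "2 ^ i * M"] \<open>M > 0\<close>
      by (metis coeff_0 mult_pos_pos zero_less_numeral zero_less_power zero_neq_one)
    have "degree D = (\<Sum>i<s. 2 ^ i * M)"
      unfolding D_def using \<open>M > 0\<close> nz
      by (subst degree_prod_eq_sum_degree) (simp_all add: one_plus_q_var_power)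
    also have "\<dots> = (2 ^ s - 1) * M"
      by (simp add: mask_eq_sum_exp_nat sum_distrib_right[symmetric] lessThan_def)
    also have "\<dots> = L - M" by (simp add: L_def diff_mult_distrib)
    also have "\<dots> = card {z::complex. z ^ L = 1} - card {z::complex. z ^ M = 1}"
      using \<open>L > 0\<close> \<open>M > 0\<close> by (simp add: card_roots_unity_eq)
    also have "\<dots> \<le> card S"
      unfolding S_def by (rule diff_card_le_card_Diff) (use \<open>M > 0\<close> in \<open>simp add: finite_roots_unity\<close>)
    finally show ?thesis .
  qed
  moreover have "int_poly_eval z D = 0" if "z \<in> S" for z
  proof -
    have "D * (1 - q_var ^ M) = 1 - q_var ^ L"
      unfolding D_def L_def by (rule prod_one_plus_power_doubling)
    hence "int_poly_eval z (D * (1 - q_var ^ M)) = int_poly_eval z (1 - q_var ^ L)" by simp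
    thus ?thesis using that by (simp add: S_def)
  qed
  moreover have "int_poly_eval z (q_euler (2 ^ k) (2 ^ k * m) -
      q_var ^ (2 ^ (k - 1) * (m - n)) * q_euler (2 ^ k) (2 ^ k * n)) = 0" if "z \<in> S" for z
  proof -
    have "z ^ L = 1" using that by (simp add: S_def)
    then obtain N where N: "N > 0" "z ^ N = 1" "\<And>j. 0 < j \<Longrightarrow> j < N \<Longrightarrow> z ^ j \<noteq> 1"
        "\<And>l. z ^ l = 1 \<longleftrightarrow> N dvd l"
      using obtain_multiplicative_order[OF _ \<open>L > 0\<close>] by metis
    \<comment> \<open>These restate \<open>z^L = 1\<close> and \<open>z^M \<noteq> 1\<close>;
      together they force the full power \<open>2^k\<close> into the order.\<close>
    have "N dvd 2 ^ (s + (k - 1)) * r" "\<not> N dvd 2 ^ (k - 1) * r"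
      using that N(4)[of L] N(4)[of M] by (auto simp: S_def L_def M_def power_add mult_ac)
    hence "2 ^ Suc (k - 1) dvd N" by (rule power_2_dvd_if[OF \<open>odd r\<close>])
    hence KN: "2 ^ k dvd N" using \<open>k \<ge> 1\<close> by simp
    hence "even N" using \<open>k \<ge> 1\<close> by (meson dvd_power dvd_trans less_le_trans zero_less_one)
    obtain j where j: "L = j * N" using N(4)[of L] \<open>z ^ L = 1\<close> by (metis dvdE mult.commute)
    \<comment> \<open>Both sides equal \<open>L\<close>; cancelling 2 matches the exponent of
      \<open>q_var\<close> with that of the root-of-unity congruence.\<close>
    have "2 * (2 ^ (k - 1) * (m - n)) = 2 * (N div 2 * j)"
      using L j \<open>even N\<close> K by (simp add: mult_ac)
    hence "2 ^ (k - 1) * (m - n) = N div 2 * j" by simp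
    thus ?thesis
      using q_euler_congruence_at_root_of_unity[OF KN \<open>even N\<close> N(1) _ _ N(2,3), of n m j] L j assms(2)
      by simp
  qed
  ultimately show ?thesis
    unfolding prod_eq by (rule monic_dvd_if_common_roots)
qed

end
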